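(* Let $d\in\mathbb{N}$, $0<p<\infty$ and $\varphi\in\mathcal{G}_p$ with $\varphi(1)=1$. Let $\mathcal{E}_{\mathsf G}^{X}$ denote the growth envelope function of $X=\mathcal{M}_{\varphi,p}(\mathbb{R}^d)$. (i) $\mathcal{E}_{\mathsf G}^{X}$ is bounded on $(0,\infty)$ if, and only if, $\lim_{t\to 0^+}\varphi(t)>0$. (ii) Assume that $\varphi(t)\sim t^{d/p}$ for $t>1$. Then there exists some $c>0$ such that $\mathcal{E}_{\mathsf G}^{X}(t)\le c\,t^{-1/p}$ for all $t>0$. (iii) Assume that there exist some $u>p$ and $c>0$ such that $\varphi(t)\le c\,t^{d/u}$ for all $t>0$. Then $\mathcal{E}_{\mathsf G}^{X}(t)=\infty$ for all $t>0$.
   Context: $\mathcal{G}_p$ is the set of all nondecreasing functions $\varphi:(0,\infty)\to(0,\infty)$ such that $t\mapsto \varphi(t)t^{-d/p}$ is nonincreasing. For $\varphi\in\mathcal{G}_p$, the generalised Morrey space $\mathcal{M}_{\varphi,p}(\mathbb{R}^d)$ is the set of all $f\in L_p^{\mathrm{loc}}(\mathbb{R}^d)$ with $$\|f\mid\mathcal{M}_{\varphi,p}(\mathbb{R}^d)\|:=\sup_{Q}\varphi(\ell(Q))\Big(\frac{1}{|Q|}\int_Q|f(y)|^p\,dy\Big)^{1/p}<\infty,$$ the supremum being over all dyadic cubes $Q=2^{-j}([0,1)^d+k)$, $j\in\mathbb{Z}$, $k\in\mathbb{Z}^d$, where $\ell(Q)$ is the side length; taking all cubes with sides parallel to the axes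 (or all balls, with the radius in place of $\ell(Q)$) gives an equivalent quasi-norm. For measurable $f$ on $\mathbb{R}^d$, finite a.e., $f^*(t)=\inf\{\sigma>0:\ |\{x:|f(x)|>\sigma\}|\le t\}$, $t\ge 0$ (with $\inf\emptyset=\infty$). The growth envelope function of a quasi-normed function space $X$ on $\mathbb{R}^d$ is $\mathcal{E}_{\mathsf G}^{X}(t)=\sup_{\|f\mid X\|\le 1}f^*(t)\in[0,\infty]$, $t>0$. $A(t)\sim B(t)$ on a range of $t$ means that there are constants $c_1,c_2>0$ independent of $t$ with $c_1A(t)\le B(t)\le c_2A(t)$ on that range. *)

theory Defs
  imports "HOL-Analysis.Analysis"
begin

text \<open>Functions on \<open>(0,\<infinity>)\<close> are total functions on \<open>real\<close>; only their values at positive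
  arguments matter.\<close>

definition class_G :: "nat \<Rightarrow> real \<Rightarrow> (real \<Rightarrow> real) set" where
  "class_G d p = {\<phi>. (\<forall>t>0. 0 < \<phi> t) \<and> mono_on {0<..} \<phi> \<and>
     antimono_on {0<..} (\<lambda>t. \<phi> t * t powr (- real d / p))}"

definition equiv_on :: "real set \<Rightarrow> (real \<Rightarrow> real) \<Rightarrow> (real \<Rightarrow> real) \<Rightarrow> bool" where
  "equiv_on S A B \<longleftrightarrow> (\<exists>c1>0. \<exists>c2>0. \<forall>t\<in>S. c1 * A t \<le> B t \<and> B t \<le> c2 * A t)"

definition side_length :: "int \<Rightarrow> real" where
  "side_length j = 2 powi (- j)"

definition dyadic_cube :: "int \<Rightarrow> int ^ 'n \<Rightarrow> (real ^ 'n) set" where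
  "dyadic_cube j k =
     (\<lambda>x. side_length j *\<^sub>R (x + (\<chi> i. of_int (k $ i)))) ` {x. \<forall>i. 0 \<le> x $ i \<and> x $ i < 1}"

text \<open>Functions are complex valued and Lebesgue measurable; they are not identified when they
  agree almost everywhere, as everything below is invariant under changes on null sets.\<close>

definition Lp_loc :: "real \<Rightarrow> (real ^ 'n \<Rightarrow> complex) set" where
  "Lp_loc p = {f \<in> borel_measurable lebesgue.
     \<forall>K. compact K \<longrightarrow> set_integrable lebesgue K (\<lambda>y. norm (f y) powr p)}"

text \<open>The mean below is a real-valued Bochner integral, so \<open>morrey_qnorm\<close> is meaningful only for
  functions in \<open>Lp_loc p\<close>, where the integrals over (bounded) cubes are finite; the supremum itself
  may be infinite.\<close>

definition morrey_qnorm :: "(real \<Rightarrow> real) \<Rightarrow> real \<Rightarrow> (real ^ 'n \<Rightarrow> complex) \<Rightarrow> ennreal" where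
  "morrey_qnorm \<phi> p f = (SUP (j, k) \<in> UNIV.
     ennreal (\<phi> (side_length j) *
       (1 / measure lebesgue (dyadic_cube j k) *
         (LINT y:dyadic_cube j k|lebesgue. norm (f y) powr p)) powr (1 / p)))"

definition morrey_space :: "(real \<Rightarrow> real) \<Rightarrow> real \<Rightarrow> (real ^ 'n \<Rightarrow> complex) set" where
  "morrey_space \<phi> p = {f \<in> Lp_loc p. morrey_qnorm \<phi> p f < \<infinity>}"

text \<open>In \<^typ>\<open>ennreal\<close> the infimum of the empty set is \<open>\<infinity>\<close>.\<close>

definition rearrangement :: "(real ^ 'n \<Rightarrow> complex) \<Rightarrow> real \<Rightarrow> ennreal" where
  "rearrangement f t =
     Inf {ennreal \<sigma> |\<sigma>. 0 < \<sigma> \<and> emeasure lebesgue {x. norm (f x) > \<sigma>} \<le> ennreal t}"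

text \<open>A quasi-normed function space is given by its carrier and its quasi-norm.\<close>

definition growth_envelope ::
    "(real ^ 'n \<Rightarrow> complex) set \<Rightarrow> ((real ^ 'n \<Rightarrow> complex) \<Rightarrow> ennreal) \<Rightarrow> real \<Rightarrow> ennreal" where
  "growth_envelope X qnorm t = (SUP f \<in> {f \<in> X. qnorm f \<le> 1}. rearrangement f t)"

end

theory Submission
  imports Defs
begin

text \<open>If \<open>f\<close> lies in the unit ball, Chebyshev's inequality on a cube \<open>Q\<close> of side \<open>r\<close> bounds
  \<open>|{|f| > \<sigma>} \<inter> Q|\<close> by \<open>(\<sigma> \<phi>(r))\<^sup>-\<^sup>p |Q|\<close>. If \<open>\<phi>\<close> is bounded below, small cubes and a density
  argument show that \<open>|f|\<close> is essentially bounded; if \<open>\<phi>\<close> grows like \<open>t\<^sup>d\<^sup>/\<^sup>p\<close>, letting \<open>r\<close> tend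
  to infinity gives the weak \<open>L\<^sub>p\<close> bound. Lower bounds come from multiples of characteristic
  functions: \<open>\<chi>\<^sub>Q / \<phi>(r)\<close> lies in the unit ball, and when \<open>\<phi>(t) \<le> c t\<^sup>d\<^sup>/\<^sup>u\<close> with \<open>u > p\<close>, so does
  \<open>M \<chi>\<^sub>A\<close> for a union \<open>A\<close> of small, sufficiently sparse cubes, whatever \<open>M\<close> and \<open>|A|\<close> are.\<close>

section \<open>Dyadic cubes\<close>

lemma side_length_pos [simp]: "0 < side_length j"
  by (simp add: side_length_def)

lemma side_length_minus_nat: "side_length (- int m) = 2 ^ m"
  by (simp add: side_length_def)

lemma side_length_nat: "side_length (int m) = (1/2) ^ m"
  by (simp add: side_length_def power_int_minus power_one_over inverse_eq_divide)

lemma ex_side_length_le: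
  assumes "0 < \<epsilon>"
  shows "\<exists>j. side_length j \<le> \<epsilon>"
proof -
  obtain m where "(1/2::real) ^ m < \<epsilon>"
    using real_arch_pow_inv[of \<epsilon> "1/2"] assms by auto
  then show ?thesis
    by (metis less_imp_le side_length_nat)
qed

lemma side_length_add1: "side_length (j + 1) = side_length j / 2"
proof -
  have "side_length (j + 1) = 2 powi (- j - 1)"
    by (simp add: side_length_def)
  also have "\<dots> = side_length j / 2"
    by (subst power_int_diff) (auto simp: side_length_def)
  finally show ?thesis .
qed

lemma mem_dyadic_cube:
  "x \<in> dyadic_cube j k \<longleftrightarrow>
     (\<forall>i. side_length j * of_int (k $ i) \<le> x $ i \<and> x $ i < side_length j * (of_int (k $ i) + 1))"
proof
  assume "x \<in> dyadic_cube j k"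
  then show "\<forall>i. side_length j * of_int (k $ i) \<le> x $ i \<and> x $ i < side_length j * (of_int (k $ i) + 1)"
    by (auto simp: dyadic_cube_def)
next
  assume R: "\<forall>i. side_length j * of_int (k $ i) \<le> x $ i \<and> x $ i < side_length j * (of_int (k $ i) + 1)"
  define y where "y = (\<chi> i. x $ i / side_length j - of_int (k $ i))"
  have "x = side_length j *\<^sub>R (y + (\<chi> i. of_int (k $ i)))"
    using less_imp_neq[OF side_length_pos[of j]] by (simp add: vec_eq_iff y_def)
  moreover have "0 \<le> y $ i \<and> y $ i < 1" for i
    using R[rule_format, of i] by (simp add: y_def field_simps)
  ultimately show "x \<in> dyadic_cube j k"
    unfolding dyadic_cube_def by blast
qed

text \<open>Membership as a floor condition turns disjointness, covering and nesting of cubes into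
  integer arithmetic.\<close>

lemma mem_dyadic_cube_iff_floor:
  "x \<in> dyadic_cube j k \<longleftrightarrow> (\<forall>i. \<lfloor>x $ i / side_length j\<rfloor> = k $ i)"
  unfolding mem_dyadic_cube floor_eq_iff by (simp add: field_simps)

lemma dyadic_cube_disjoint: "k \<noteq> l \<Longrightarrow> dyadic_cube j k \<inter> dyadic_cube j l = {}"
  by (auto simp: mem_dyadic_cube_iff_floor vec_eq_iff)

lemma ex_dyadic_cube: "\<exists>k. x \<in> dyadic_cube j k"
  by (rule exI[of _ "\<chi> i. \<lfloor>x $ i / side_length j\<rfloor>"]) (simp add: mem_dyadic_cube_iff_floor)

text \<open>Halving the side refines the grid: the coarse index is the fine index divided by 2 and
  rounded down, so one common point decides containment.\<close>

lemma dyadic_cube_subset: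
  assumes "x \<in> dyadic_cube (j + 1) l" "x \<in> dyadic_cube j k"
  shows "dyadic_cube (j + 1) l \<subseteq> dyadic_cube j k"
proof
  fix z assume z: "z \<in> dyadic_cube (j + 1) l"
  have half: "\<lfloor>y / side_length j\<rfloor> = \<lfloor>y / side_length (j + 1)\<rfloor> div 2" for y
    using floor_divide_real_eq_div[of 2 "y / side_length (j + 1)"]
    by (simp add: side_length_add1)
  show "z \<in> dyadic_cube j k"
    using assms z unfolding mem_dyadic_cube_iff_floor half by simp
qed

text \<open>Serves both to fit small cubes into a ball and to force a cube that meets two distant
  cubes to be large.\<close>

lemma dyadic_cube_component_diff:
  "\<lbrakk>x \<in> dyadic_cube j k; y \<in> dyadic_cube j k\<rbrakk> \<Longrightarrow> \<bar>x $ i - y $ i\<bar> < side_length j"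
  unfolding mem_dyadic_cube by (drule spec[of _ i])+ (auto simp: algebra_simps)

section \<open>Measurability and volume of dyadic cubes\<close>

lemma dyadic_cube_subset_cbox:
  "dyadic_cube j k \<subseteq> cbox (\<chi> i. side_length j * of_int (k $ i)) (\<chi> i. side_length j * (of_int (k $ i) + 1))"
  by (auto simp: mem_dyadic_cube mem_box_cart less_imp_le)

lemma box_subset_dyadic_cube:
  "box (\<chi> i. side_length j * of_int (k $ i)) (\<chi> i. side_length j * (of_int (k $ i) + 1)) \<subseteq> dyadic_cube j k"
  by (auto simp: mem_dyadic_cube mem_box_cart less_imp_le)

lemma dyadic_cube_borel: "dyadic_cube j k \<in> sets borel"
proof -
  have "dyadic_cube j k = (\<Inter>i. {x. side_length j * of_int (k $ i) \<le> x $ i} \<inter>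
      {x. x $ i < side_length j * (of_int (k $ i) + 1)})"
    by (auto simp: mem_dyadic_cube)
  also have "\<dots> \<in> sets borel"
    by (intro sets.countable_INT'' sets.Int borel_closed borel_open
        closed_halfspace_component_ge_cart open_halfspace_component_lt_cart) auto
  finally show ?thesis .
qed

lemma dyadic_cube_sets [measurable, simp]: "dyadic_cube j k \<in> sets lebesgue"
  by (rule sets_completionI_sets) (simp add: dyadic_cube_borel)

text \<open>The half-open cube is squeezed between an open and a closed box of equal
  measure.\<close>

lemma emeasure_dyadic_cube:
  fixes k :: "int ^ 'n"
  shows "emeasure lebesgue (dyadic_cube j k) = ennreal (side_length j ^ CARD('n))"
proof -
  let ?a = "(\<chi> i. side_length j * of_int (k $ i)) :: real ^ 'n"
  let ?b = "(\<chi> i. side_length j * (of_int (k $ i) + 1)) :: real ^ 'n"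
  have nn: "0 \<le> side_length j" using side_length_pos[of j] by linarith
  have le: "\<And>i. i \<in> Basis \<Longrightarrow> ?a \<bullet> i \<le> ?b \<bullet> i"
    using nn by (auto simp: Basis_vec_def inner_axis algebra_simps)
  have prod: "(\<Prod>i\<in>Basis. (?b - ?a) \<bullet> i) = side_length j ^ CARD('n)"
  proof -
    have "(\<Prod>i\<in>Basis. (?b - ?a) \<bullet> i) = (\<Prod>i\<in>(Basis::(real^'n) set). side_length j)"
      by (intro prod.cong) (auto simp: Basis_vec_def inner_axis algebra_simps)
    then show ?thesis by simp
  qed
  have "emeasure lebesgue (dyadic_cube j k) \<le> emeasure lebesgue (cbox ?a ?b)"
    by (intro emeasure_mono dyadic_cube_subset_cbox) auto
  moreover have "emeasure lebesgue (box ?a ?b) \<le> emeasure lebesgue (dyadic_cube j k)"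
    by (intro emeasure_mono box_subset_dyadic_cube) auto
  ultimately show ?thesis
    using le prod by (simp add: emeasure_lborel_cbox emeasure_lborel_box)
qed

lemma dyadic_cube_lmeasurable [simp]: "dyadic_cube j k \<in> lmeasurable"
  by (simp add: fmeasurable_def emeasure_dyadic_cube)

lemma measure_dyadic_cube:
  fixes k :: "int ^ 'n"
  shows "measure lebesgue (dyadic_cube j k) = side_length j ^ CARD('n)"
  by (simp add: measure_def emeasure_dyadic_cube)

section \<open>Level sets of functions in the unit ball\<close>

lemma Lp_loc_integrable_cube:
  assumes "f \<in> Lp_loc p"
  shows "set_integrable lebesgue (dyadic_cube j k) (\<lambda>y. norm (f y) powr p)"
proof (rule set_integrable_subset)
  show "set_integrable lebesgue
      (cbox (\<chi> i. side_length j * of_int (k $ i)) (\<chi> i. side_length j * (of_int (k $ i) + 1)))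
      (\<lambda>y. norm (f y) powr p)"
    using assms by (auto simp: Lp_loc_def)
qed (use dyadic_cube_subset_cbox in auto)

lemma level_set_sets:
  assumes "f \<in> Lp_loc p"
  shows "{x. norm (f x) > \<sigma>} \<in> sets lebesgue"
proof -
  have [measurable]: "f \<in> borel_measurable lebesgue"
    using assms by (auto simp: Lp_loc_def)
  have "{x \<in> space lebesgue. norm (f x) > \<sigma>} \<in> sets lebesgue"
    by measurable
  then show ?thesis by simp
qed

text \<open>Chebyshev's inequality, with the mean on this one cube bounded through the quasi-norm.
  The lower bound \<open>b\<close> stands in for the value of \<open>\<phi>\<close>, so that a
  constant (part (i)) or a multiple of \<open>r powr (d / p)\<close> (part (ii)) can be
  inserted.\<close>

lemma measure_level_set_cube_le:
  fixes f :: "real ^ 'n \<Rightarrow> complex"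
  assumes f: "f \<in> Lp_loc p" and norm: "morrey_qnorm \<phi> p f \<le> 1"
    and p: "0 < p" and \<sigma>: "0 < \<sigma>" and b: "0 < b" "b \<le> \<phi> (side_length j)"
  shows "measure lebesgue ({x. norm (f x) > \<sigma>} \<inter> dyadic_cube j k)
    \<le> (\<sigma> * b) powr (- p) * side_length j ^ CARD('n)"
proof -
  let ?Q = "dyadic_cube j k :: (real ^ 'n) set"
  let ?A = "{x. norm (f x) > \<sigma>}"
  define I where "I = (LINT y:?Q|lebesgue. norm (f y) powr p)"
  define V where "V = side_length j ^ CARD('n)"
  have V: "0 < V" by (simp add: V_def)
  have A [measurable]: "?A \<in> sets lebesgue" using f by (rule level_set_sets)
  have AQ: "?A \<inter> ?Q \<in> lmeasurable" by (simp add: fmeasurable_Int_fmeasurable A Int_commute[of ?A])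
  have I0: "0 \<le> I"
    unfolding I_def set_lebesgue_integral_def by (intro Bochner_Integration.integral_nonneg) auto
  have "ennreal (\<phi> (side_length j) * (1 / V * I) powr (1 / p)) \<le> morrey_qnorm \<phi> p f"
    unfolding morrey_qnorm_def I_def V_def
    by (rule SUP_upper2[of "(j, k)"]) (auto simp: measure_dyadic_cube)
  then have "ennreal (\<phi> (side_length j) * (1 / V * I) powr (1 / p)) \<le> 1"
    using norm by (rule order_trans)
  then have "\<phi> (side_length j) * (1 / V * I) powr (1 / p) \<le> 1"
    by (metis ennreal_1 ennreal_le_iff zero_le_one)
  then have "b * (1 / V * I) powr (1 / p) \<le> 1"
    using b by (smt (verit) mult_right_mono powr_ge_zero)
  then have "(1 / V * I) powr (1 / p) \<le> 1 / b"
    using b by (simp add: field_simps)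
  then have "((1 / V * I) powr (1 / p)) powr p \<le> (1 / b) powr p"
    using p by (intro powr_mono2) auto
  then have "1 / V * I \<le> (1 / b) powr p"
    using p I0 V by (simp add: powr_powr)
  then have I: "I \<le> b powr (- p) * V"
    using V b by (simp add: field_simps powr_divide powr_minus)
  \<comment> \<open>Chebyshev step: \<open>\<sigma> powr p\<close> is a lower bound of the integrand
    on the level set.\<close>
  have "\<sigma> powr p * measure lebesgue (?A \<inter> ?Q) = (LINT y|lebesgue. \<sigma> powr p * indicator (?A \<inter> ?Q) y)"
    by simp
  also have "\<dots> \<le> I"
    unfolding I_def set_lebesgue_integral_def
  proof (rule integral_mono)
    show "integrable lebesgue (\<lambda>y. \<sigma> powr p * indicator (?A \<inter> ?Q) y)"
      using AQ by (intro integrable_mult_right) (auto simp: fmeasurable_def)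
    show "integrable lebesgue (\<lambda>y. indicator ?Q y *\<^sub>R norm (f y) powr p)"
      using Lp_loc_integrable_cube[OF f] by (simp add: set_integrable_def)
    show "\<sigma> powr p * indicator (?A \<inter> ?Q) y \<le> indicator ?Q y *\<^sub>R norm (f y) powr p" for y
      using \<sigma> p by (auto simp: indicator_def intro!: powr_mono2)
  qed
  finally have "\<sigma> powr p * measure lebesgue (?A \<inter> ?Q) \<le> b powr (- p) * V"
    using I by linarith
  then show ?thesis
    using \<sigma> b unfolding V_def [symmetric]
    by (simp add: powr_mult powr_minus field_simps)
qed

lemma rearrangement_le:
  assumes "0 < \<sigma>" "emeasure lebesgue {x. norm (f x) > \<sigma>} \<le> ennreal t"
  shows "rearrangement f t \<le> ennreal \<sigma>"
  unfolding rearrangement_def using assms by (intro Inf_lower) auto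

text \<open>A form of Lebesgue's density theorem: the cubes of level \<open>m\<close> contained in an open set \<open>U\<close>
  exhaust \<open>U\<close> as \<open>m\<close> grows, and \<open>U\<close> is then chosen close to the part of \<open>A\<close> in a ball.\<close>

lemma null_set_if_small_density_on_cubes:
  fixes A :: "(real ^ 'n) set"
  assumes A [measurable]: "A \<in> sets lebesgue" and \<theta>: "0 \<le> \<theta>" "\<theta> < 1"
    and dens: "\<And>j k. measure lebesgue (A \<inter> dyadic_cube j k) \<le> \<theta> * side_length j ^ CARD('n)"
  shows "emeasure lebesgue A = 0"
proof -
  have cube: "emeasure lebesgue (A \<inter> dyadic_cube j k) \<le> ennreal \<theta> * emeasure lebesgue (dyadic_cube j k)" for j k
  proof -
    have "A \<inter> dyadic_cube j k \<in> lmeasurable"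
      by (simp add: fmeasurable_Int_fmeasurable A Int_commute[of A])
    then show ?thesis
      using dens[of j k] \<theta>
      by (simp add: emeasure_eq_measure2 emeasure_dyadic_cube ennreal_leI flip: ennreal_mult')
  qed
  have countable_vec: "countable K" for K :: "(int ^ 'n) set"
    by (rule countableI_type)
  have open_le: "emeasure lebesgue (A \<inter> U) \<le> ennreal \<theta> * emeasure lebesgue U" if U: "open U" for U
  proof -
    define K where "K m = {k. dyadic_cube (int m) k \<subseteq> U}" for m
    define W where "W m = (\<Union>k\<in>K m. dyadic_cube (int m) k)" for m
    have W_sets [measurable]: "W m \<in> sets lebesgue" for m
      unfolding W_def using countable_vec by (intro sets.countable_UN') auto
    have WU: "W m \<subseteq> U" for m by (auto simp: W_def K_def)
    have mono: "W m \<subseteq> W (Suc m)" for m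
    proof
      fix x assume "x \<in> W m"
      then obtain k where k: "x \<in> dyadic_cube (int m) k" "dyadic_cube (int m) k \<subseteq> U"
        by (auto simp: W_def K_def)
      obtain l where l: "x \<in> dyadic_cube (int m + 1) l" using ex_dyadic_cube by blast
      have "dyadic_cube (int m + 1) l \<subseteq> U"
        using dyadic_cube_subset[OF l k(1)] k(2) by blast
      then show "x \<in> W (Suc m)"
        using l unfolding W_def K_def by (auto simp: add.commute)
    qed
    have exhaust: "(\<Union>m. W m) = U"
    proof (intro antisym subsetI)
      fix x assume "x \<in> U"
      then obtain e where e: "0 < e" "ball x e \<subseteq> U" using U open_contains_ball by blast
      \<comment> \<open>The norm is at most the sum of the coordinates' absolute values, hence the
        division of \<open>e\<close> by the dimension.\<close>
      obtain m where m: "(1/2::real) ^ m < e / CARD('n)"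
        using real_arch_pow_inv[of "e / CARD('n)" "1/2"] e by auto
      obtain k where k: "x \<in> dyadic_cube (int m) k" using ex_dyadic_cube by blast
      have "dyadic_cube (int m) k \<subseteq> ball x e"
      proof
        fix z assume z: "z \<in> dyadic_cube (int m) k"
        have "norm (x - z) \<le> (\<Sum>i\<in>UNIV. \<bar>(x - z) $ i\<bar>)" by (rule norm_le_l1_cart)
        also have "\<dots> \<le> (\<Sum>i\<in>(UNIV::'n set). (1/2) ^ m)"
          using dyadic_cube_component_diff[OF k z]
          by (intro sum_mono) (auto simp: side_length_nat less_imp_le)
        also have "\<dots> < e" using m by (simp add: field_simps)
        finally show "z \<in> ball x e" by (simp add: dist_norm)
      qed
      then have "x \<in> W m" using k e unfolding W_def K_def by blast
      then show "x \<in> (\<Union>m. W m)" by blast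
    qed (use WU in blast)
    have W_le: "emeasure lebesgue (A \<inter> W m) \<le> ennreal \<theta> * emeasure lebesgue U" for m
    proof -
      have disj: "disjoint_family_on (\<lambda>k. dyadic_cube (int m) k) (K m)"
        unfolding disjoint_family_on_def using dyadic_cube_disjoint by blast
      have "emeasure lebesgue (A \<inter> W m) = emeasure lebesgue (\<Union>k\<in>K m. A \<inter> dyadic_cube (int m) k)"
        by (simp add: W_def)
      also have "\<dots> = (\<integral>\<^sup>+k. emeasure lebesgue (A \<inter> dyadic_cube (int m) k) \<partial>count_space (K m))"
        using disj countable_vec by (intro emeasure_UN_countable) (auto simp: disjoint_family_on_def)
      also have "\<dots> \<le> (\<integral>\<^sup>+k. ennreal \<theta> * emeasure lebesgue (dyadic_cube (int m) k :: (real^'n) set) \<partial>count_space (K m))"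
        by (intro nn_integral_mono cube)
      also have "\<dots> = ennreal \<theta> * (\<integral>\<^sup>+k. emeasure lebesgue (dyadic_cube (int m) k :: (real^'n) set) \<partial>count_space (K m))"
        by (intro nn_integral_cmult) auto
      also have "\<dots> = ennreal \<theta> * emeasure lebesgue (W m)"
        unfolding W_def using disj countable_vec by (subst emeasure_UN_countable) auto
      also have "\<dots> \<le> ennreal \<theta> * emeasure lebesgue U"
        using WU U by (intro mult_left_mono emeasure_mono) auto
      finally show ?thesis .
    qed
    have "emeasure lebesgue (A \<inter> U) = emeasure lebesgue (\<Union>m. A \<inter> W m)"
      using exhaust by (metis Int_UN_distrib)
    also have "\<dots> = (SUP m. emeasure lebesgue (A \<inter> W m))"
      using mono by (intro SUP_emeasure_incseq[symmetric] incseq_SucI) auto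
    also have "\<dots> \<le> ennreal \<theta> * emeasure lebesgue U"
      by (intro SUP_least W_le)
    finally show ?thesis .
  qed
  have bounded: "emeasure lebesgue (A \<inter> ball 0 (real m)) = 0" for m
  proof -
    let ?B = "A \<inter> ball 0 (real m)"
    have B: "?B \<in> lmeasurable"
      by (simp add: fmeasurable_Int_fmeasurable A Int_commute[of A])
    \<comment> \<open>As \<open>\<theta> < 1\<close>, this forces measure zero; cutting with a ball
      makes the measure finite, so that it can be subtracted.\<close>
    have "measure lebesgue ?B \<le> \<theta> * measure lebesgue ?B"
    proof (rule field_le_epsilon)
      fix e :: real assume e: "0 < e"
      obtain U where U: "open U" "?B \<subseteq> U" "U \<in> lmeasurable" "measure lebesgue U < measure lebesgue ?B + e"
      proof -
        obtain U where U: "open U" "?B \<subseteq> U" "U - ?B \<in> lmeasurable" "emeasure lebesgue (U - ?B) < ennreal e"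
          using sets_lebesgue_outer_open[OF fmeasurableD[OF B] e] by blast
        have "?B \<union> (U - ?B) \<in> lmeasurable" using B U(3) by (rule fmeasurable.Un)
        moreover have "?B \<union> (U - ?B) = U" using U(2) by blast
        ultimately have meas: "U \<in> lmeasurable" by simp
        have "measure lebesgue U - measure lebesgue ?B = measure lebesgue (U - ?B)"
          using B meas U(2) by (simp add: measurable_measure_Diff fmeasurableD)
        also have "\<dots> < e"
          using U(3,4) e by (simp add: emeasure_eq_measure2 ennreal_less_iff)
        finally show ?thesis using that U(1,2) meas by simp
      qed
      have "emeasure lebesgue ?B \<le> emeasure lebesgue (A \<inter> U)"
        using U by (intro emeasure_mono) auto
      also note open_le[OF U(1)]
      finally have "measure lebesgue ?B \<le> \<theta> * measure lebesgue U"
        using B U \<theta> by (simp add: emeasure_eq_measure2 flip: ennreal_mult')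
      also have "\<dots> \<le> \<theta> * (measure lebesgue ?B + e)"
        using U \<theta> by (intro mult_left_mono) auto
      also have "\<dots> \<le> \<theta> * measure lebesgue ?B + e"
        using \<theta> e by (simp add: algebra_simps mult_left_le_one_le)
      finally show "measure lebesgue ?B \<le> \<theta> * measure lebesgue ?B + e" .
    qed
    then have "(1 - \<theta>) * measure lebesgue ?B \<le> 0" by (simp add: algebra_simps)
    then have "measure lebesgue ?B \<le> 0" using \<theta> by (simp add: mult_le_0_iff)
    then have "measure lebesgue ?B = 0" using measure_nonneg[of lebesgue ?B] by linarith
    then show ?thesis using B by (simp add: emeasure_eq_measure2)
  qed
  have "(\<Union>m. A \<inter> ball 0 (real m)) = A"
    using reals_Archimedean2 by (auto simp: dist_norm)
  moreover have "emeasure lebesgue (\<Union>m. A \<inter> ball 0 (real m)) = 0"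
    using bounded by (intro emeasure_UN_eq_0) auto
  ultimately show ?thesis by simp
qed

lemma finite_vec_components_in:
  assumes "finite S"
  shows "finite {k :: 'a ^ 'n::finite. \<forall>i. k $ i \<in> S}"
proof (rule finite_subset)
  show "{k :: 'a ^ 'n. \<forall>i. k $ i \<in> S} \<subseteq> vec_lambda ` (UNIV \<rightarrow>\<^sub>E S)"
  proof
    fix k :: "'a ^ 'n" assume "k \<in> {k. \<forall>i. k $ i \<in> S}"
    then have "k = vec_lambda (\<lambda>i. k $ i)" "(\<lambda>i. k $ i) \<in> UNIV \<rightarrow>\<^sub>E S" by auto
    then show "k \<in> vec_lambda ` (UNIV \<rightarrow>\<^sub>E S)" by blast
  qed
qed (use assms in \<open>simp add: finite_PiE\<close>)

text \<open>The constant only depends on the dimension: it counts the cubes of a level that touch the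
  origin.\<close>

lemma ex_emeasure_le_of_large_cubes:
  "\<exists>N>0. \<forall>A \<in> sets (lebesgue :: (real ^ 'n) measure). \<forall>b\<ge>0.
     (\<forall>m k. 0 < m \<longrightarrow> measure lebesgue (A \<inter> dyadic_cube (- int m) k) \<le> b) \<longrightarrow>
     emeasure lebesgue A \<le> ennreal (N * b)"
proof -
  define K where "K = {k :: int ^ 'n. \<forall>i. k $ i \<in> {-1, 0}}"
  have K: "finite K" unfolding K_def by (rule finite_vec_components_in) simp
  have "0 \<in> K" by (simp add: K_def)
  then have card: "0 < card K" using K card_gt_0_iff by blast
  show ?thesis
  proof (intro exI[of _ "real (card K)"] conjI ballI allI impI)
    fix A :: "(real ^ 'n) set" and b :: real
    assume A [measurable]: "A \<in> sets lebesgue" and b: "0 \<le> b"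
      and le: "\<forall>m k. 0 < m \<longrightarrow> measure lebesgue (A \<inter> dyadic_cube (- int m) k) \<le> b"
    \<comment> \<open>These boxes are covered by the cubes of side \<open>2 ^ Suc m\<close> with
      index in \<open>K\<close>. The exponent \<open>Suc m\<close> keeps the level within the
      hypothesis, which speaks of sides above 1 only.\<close>
    define W where "W m = {x :: real ^ 'n. \<forall>i. - (2 ^ Suc m) \<le> x $ i \<and> x $ i < 2 ^ Suc m}" for m
    have W_cover: "W m \<subseteq> (\<Union>k\<in>K. dyadic_cube (- int (Suc m)) k)" for m
    proof
      fix x assume x: "x \<in> W m"
      obtain k where k: "x \<in> dyadic_cube (- int (Suc m)) k" using ex_dyadic_cube by blast
      have "k $ i \<in> {-1, 0}" for i
      proof -
        have *: "- 1 \<le> x $ i / 2 ^ Suc m" "x $ i / 2 ^ Suc m < 1"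
          using x[unfolded W_def] by (auto simp: field_simps)
        have "k $ i = \<lfloor>x $ i / 2 ^ Suc m\<rfloor>"
          using k unfolding mem_dyadic_cube_iff_floor side_length_minus_nat by simp
        with * show ?thesis by (simp; linarith)
      qed
      then show "x \<in> (\<Union>k\<in>K. dyadic_cube (- int (Suc m)) k)" using k by (auto simp: K_def)
    qed
    have "(\<Inter>i. {x :: real ^ 'n. - (2 ^ Suc m) \<le> x $ i} \<inter> {x. x $ i < 2 ^ Suc m}) \<in> sets borel" for m
      by (intro sets.countable_INT'' sets.Int borel_closed borel_open
        closed_halfspace_component_ge_cart open_halfspace_component_lt_cart) auto
    moreover have "(\<Inter>i. {x :: real ^ 'n. - (2 ^ Suc m) \<le> x $ i} \<inter> {x. x $ i < 2 ^ Suc m}) = W m" for m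
      by (auto simp: W_def)
    ultimately have "W m \<in> sets borel" for m
      by metis
    then have W_sets [measurable]: "W m \<in> sets lebesgue" for m
      by (intro sets_completionI_sets) simp
    have W_mono: "W m \<subseteq> W (Suc m)" for m
    proof
      fix x assume x: "x \<in> W m"
      have "(2::real) ^ Suc m \<le> 2 ^ Suc (Suc m)" by simp
      then show "x \<in> W (Suc m)"
        using x unfolding W_def by (smt (verit) mem_Collect_eq)
    qed
    have W_UNIV: "(\<Union>m. W m) = UNIV"
    proof -
      have "\<exists>m. x \<in> W m" for x
      proof -
        obtain m where m: "norm x < 2 ^ m"
          using real_arch_pow[of 2 "norm x"] by auto
        have "\<bar>x $ i\<bar> < 2 ^ Suc m" for i
          using component_le_norm_cart[of x i] m zero_less_power[of "2::real" m] by simp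
        then have "x \<in> W m" unfolding W_def by (smt (verit) mem_Collect_eq)
        then show ?thesis ..
      qed
      then show ?thesis by blast
    qed
    have "emeasure lebesgue (A \<inter> W m) \<le> ennreal (card K * b)" for m
    proof -
      have m: "A \<inter> dyadic_cube (- int (Suc m)) k \<in> lmeasurable" for k
        by (simp only: Int_commute[of A] fmeasurable_Int_fmeasurable A dyadic_cube_lmeasurable)
      have "emeasure lebesgue (A \<inter> W m) \<le> emeasure lebesgue (\<Union>k\<in>K. A \<inter> dyadic_cube (- int (Suc m)) k)"
        using W_cover K by (intro emeasure_mono sets.finite_UN) auto
      also have "\<dots> \<le> (\<Sum>k\<in>K. emeasure lebesgue (A \<inter> dyadic_cube (- int (Suc m)) k))"
        using K by (intro emeasure_subadditive_finite) auto
      also have "\<dots> \<le> (\<Sum>k\<in>K. ennreal b)"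
        using le b m by (intro sum_mono) (simp only: emeasure_eq_measure2 ennreal_leI zero_less_Suc)
      also have "\<dots> = ennreal (card K * b)" by (simp add: ennreal_mult' ennreal_of_nat_eq_real_of_nat)
      finally show ?thesis .
    qed
    then have "(SUP m. emeasure lebesgue (A \<inter> W m)) \<le> ennreal (card K * b)"
      by (intro SUP_least)
    also have "(SUP m. emeasure lebesgue (A \<inter> W m)) = emeasure lebesgue (\<Union>m. A \<inter> W m)"
      using W_mono by (intro SUP_emeasure_incseq incseq_SucI) auto
    also have "(\<Union>m. A \<inter> W m) = A" using W_UNIV by blast
    finally show "emeasure lebesgue A \<le> ennreal (card K * b)" .
  qed (use card in simp)
qed

section \<open>Multiples of characteristic functions\<close>

text \<open>The factor \<open>M\<close> comes out of the mean when the root is taken, so membership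
  in the unit ball reduces to a bound on the share of each cube that \<open>A\<close>
  covers.\<close>

lemma morrey_indicator:
  fixes A :: "(real ^ 'n) set"
  assumes A: "A \<in> lmeasurable" and M: "0 < M" and p: "0 < p"
    and le: "\<And>j k. \<phi> (side_length j) *
      (measure lebesgue (A \<inter> dyadic_cube j k) / side_length j ^ CARD('n)) powr (1 / p) \<le> 1 / M"
  shows "(\<lambda>x. complex_of_real (M * indicator A x)) \<in> morrey_space \<phi> p"
    and "morrey_qnorm \<phi> p (\<lambda>x. complex_of_real (M * indicator A x)) \<le> 1"
proof -
  let ?f = "\<lambda>x. complex_of_real (M * indicator A x)"
  have [measurable]: "A \<in> sets lebesgue" using A by (simp add: fmeasurable_def)
  have f: "norm (?f x) powr p = M powr p * indicator A x" for x
    using M p by (simp add: indicator_def)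
  have int: "(LINT y:B|lebesgue. norm (?f y) powr p) = M powr p * measure lebesgue (A \<inter> B)" for B
  proof -
    have "(LINT y:B|lebesgue. norm (?f y) powr p) = (LINT y|lebesgue. M powr p * indicator (A \<inter> B) y)"
      unfolding set_lebesgue_integral_def f
      by (intro Bochner_Integration.integral_cong) (auto simp: indicator_def)
    then show ?thesis by simp
  qed
  have Lp: "?f \<in> Lp_loc p"
    unfolding Lp_loc_def
  proof (intro CollectI conjI allI impI)
    fix K :: "(real ^ 'n) set" assume "compact K"
    then have [measurable]: "K \<in> sets lebesgue" by (simp add: borel_compact)
    have "integrable lebesgue (\<lambda>y. M powr p * indicator A y)"
      using A by (intro integrable_mult_right) (auto simp: fmeasurable_def)
    then show "set_integrable lebesgue K (\<lambda>y. norm (?f y) powr p)"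
      unfolding f set_integrable_def by (rule integrable_mult_indicator[rotated]) measurable
  qed measurable
  have "morrey_qnorm \<phi> p ?f \<le> 1"
    unfolding morrey_qnorm_def
  proof (rule SUP_least, clarify)
    fix j :: int and k :: "int ^ 'n"
    let ?m = "measure lebesgue (A \<inter> dyadic_cube j k) / side_length j ^ CARD('n)"
    have "(1 / measure lebesgue (dyadic_cube j k) *
       (LINT y:dyadic_cube j k|lebesgue. norm (?f y) powr p)) powr (1 / p)
      = (M powr p * ?m) powr (1 / p)"
      by (simp only: int measure_dyadic_cube) (simp add: field_simps)
    also have "\<dots> = M * ?m powr (1 / p)"
      using M p by (subst powr_mult) (auto simp: powr_powr less_imp_le[OF side_length_pos])
    also have "\<phi> (side_length j) * \<dots> \<le> 1"
      using le[of j k] M by (simp add: field_simps)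
    finally show "ennreal (\<phi> (side_length j) * (1 / measure lebesgue (dyadic_cube j k) *
       (LINT y:dyadic_cube j k|lebesgue. norm (?f y) powr p)) powr (1 / p)) \<le> 1"
      by (metis ennreal_1 ennreal_leI)
  qed
  then show "morrey_qnorm \<phi> p ?f \<le> 1" .
  then have "morrey_qnorm \<phi> p ?f < \<infinity>"
    by (rule order_le_less_trans) (simp add: less_top[symmetric])
  with Lp show "?f \<in> morrey_space \<phi> p" by (simp add: morrey_space_def)
qed

text \<open>Were some \<open>\<sigma> < M\<close> admissible, its level set would be all of
  \<open>A\<close>, whose measure exceeds \<open>t\<close>.\<close>

lemma rearrangement_indicator_ge:
  fixes A :: "(real ^ 'n) set"
  assumes A: "A \<in> lmeasurable" and t: "0 \<le> t" "t < measure lebesgue A"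
  shows "ennreal M \<le> rearrangement (\<lambda>x. complex_of_real (M * indicator A x)) t"
  unfolding rearrangement_def
proof (rule Inf_greatest, clarify)
  fix \<sigma> :: real
  assume \<sigma>: "0 < \<sigma>"
    and le: "emeasure lebesgue {x. \<sigma> < cmod (complex_of_real (M * indicator A x))} \<le> ennreal t"
  show "ennreal M \<le> ennreal \<sigma>"
  proof (rule ccontr)
    assume "\<not> ennreal M \<le> ennreal \<sigma>"
    then have "\<sigma> < M" using ennreal_leI not_le by blast
    then have "{x. \<sigma> < cmod (complex_of_real (M * indicator A x))} = A"
      using \<sigma> by (auto simp: indicator_def split: if_splits)
    then show False using le A t by (simp add: emeasure_eq_measure2)
  qed
qed

text \<open>Common source of both lower bounds, the necessity in part (i) and the infinite envelope
  in part (iii); only \<open>A\<close> and \<open>M\<close> differ.\<close>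

lemma growth_envelope_ge:
  fixes A :: "(real ^ 'n) set"
  assumes A: "A \<in> lmeasurable" and M: "0 < M" and p: "0 < p"
    and le: "\<And>j k. \<phi> (side_length j) *
      (measure lebesgue (A \<inter> dyadic_cube j k) / side_length j ^ CARD('n)) powr (1 / p) \<le> 1 / M"
    and t: "0 \<le> t" "t < measure lebesgue A"
  shows "ennreal M \<le> growth_envelope (morrey_space \<phi> p :: (real ^ 'n \<Rightarrow> complex) set) (morrey_qnorm \<phi> p) t"
  unfolding growth_envelope_def
  using morrey_indicator[OF A M p le] rearrangement_indicator_ge[OF A t]
  by (intro SUP_upper2[of "\<lambda>x. complex_of_real (M * indicator A x)"]) auto

section \<open>Consequences of the monotonicity conditions on \<phi>\<close>

lemma class_G_pos: "\<phi> \<in> class_G d p \<Longrightarrow> 0 < t \<Longrightarrow> 0 < \<phi> t"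
  by (simp add: class_G_def)

lemma class_G_mono: "\<phi> \<in> class_G d p \<Longrightarrow> 0 < s \<Longrightarrow> s \<le> t \<Longrightarrow> \<phi> s \<le> \<phi> t"
  by (auto simp: class_G_def mono_on_def)

text \<open>The inequality behind the boundedness of the normalised characteristic functions of cubes:
  \<open>v\<close> stands for the share of a cube of side \<open>r\<close> occupied by a cube of side \<open>s\<close>.\<close>

lemma class_G_share_le:
  assumes G: "\<phi> \<in> class_G d p" and p: "0 < p" and rs: "0 < r" "0 < s"
    and v: "0 \<le> v" "v \<le> 1" "v \<le> (s / r) ^ d"
  shows "\<phi> r * v powr (1 / p) \<le> \<phi> s"
\<comment> \<open>For small \<open>r\<close> the growth of \<phi> and \<open>v \<le> 1\<close>
  suffice; for large \<open>r\<close> the decay of \<open>\<phi>(t) t powr (- d / p)\<close>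
  compensates the share \<open>(s / r) ^ d\<close> exactly.\<close>
proof (cases "r \<le> s")
  case True
  have "v powr (1 / p) \<le> 1" using v p by (intro powr_le1) auto
  then have "\<phi> r * v powr (1 / p) \<le> \<phi> r"
    using class_G_pos[OF G rs(1)] by (simp add: mult_left_le)
  also have "\<dots> \<le> \<phi> s" using class_G_mono[OF G rs(1) True] .
  finally show ?thesis .
next
  case False
  then have "\<phi> r * r powr (- real d / p) \<le> \<phi> s * s powr (- real d / p)"
    using G rs unfolding class_G_def by (auto simp: monotone_on_def)
  then have *: "\<phi> r * r powr (- real d / p) * s powr (d / p) \<le> \<phi> s * s powr (- real d / p) * s powr (d / p)"
    by (rule mult_right_mono) simp
  have "v powr (1 / p) \<le> ((s / r) ^ d) powr (1 / p)" using v p by (intro powr_mono2) auto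
  also have "\<dots> = (s / r) powr (d / p)"
    using rs by (simp add: powr_powr flip: powr_realpow)
  also have "\<dots> = r powr (- real d / p) * s powr (d / p)"
    using rs by (simp add: powr_divide powr_minus field_simps)
  finally have "\<phi> r * v powr (1 / p) \<le> \<phi> r * (r powr (- real d / p) * s powr (d / p))"
    using class_G_pos[OF G rs(1)] by (intro mult_left_mono) auto
  also have "\<dots> \<le> \<phi> s * s powr (- real d / p) * s powr (d / p)" using * by (simp add: mult.assoc)
  also have "\<dots> = \<phi> s" using rs by (simp add: mult.assoc flip: powr_add)
  finally show ?thesis .
qed

text \<open>The part of \<open>A\<close> in the tested cube has at most the volume of either cube,
  which yields both bounds on the share. Since only this part must lie in a single cube,
  \<open>A\<close> may itself be a union of cubes.\<close>

lemma class_G_cube_share_le: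
  fixes A :: "(real ^ 'n) set"
  assumes G: "\<phi> \<in> class_G CARD('n) p" and p: "0 < p"
    and A: "A \<in> lmeasurable" and sub: "A \<inter> dyadic_cube j k \<subseteq> dyadic_cube i l"
  shows "\<phi> (side_length j) *
    (measure lebesgue (A \<inter> dyadic_cube j k) / side_length j ^ CARD('n)) powr (1 / p) \<le> \<phi> (side_length i)"
proof (rule class_G_share_le[OF G p])
  have V: "0 < side_length j ^ CARD('n)" by simp
  have sets: "A \<inter> dyadic_cube j k \<in> sets lebesgue" using A by (auto simp: fmeasurable_def)
  show "0 \<le> measure lebesgue (A \<inter> dyadic_cube j k) / side_length j ^ CARD('n)"
    using V by (simp add: less_imp_le)
  have "measure lebesgue (A \<inter> dyadic_cube j k) \<le> side_length j ^ CARD('n)"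
    using measure_mono_fmeasurable[of "A \<inter> dyadic_cube j k" "dyadic_cube j k" lebesgue] sets
    by (simp add: measure_dyadic_cube)
  then show "measure lebesgue (A \<inter> dyadic_cube j k) / side_length j ^ CARD('n) \<le> 1"
    using V by simp
  have "measure lebesgue (A \<inter> dyadic_cube j k) \<le> side_length i ^ CARD('n)"
    using measure_mono_fmeasurable[OF sub, of lebesgue] sets by (simp add: measure_dyadic_cube)
  then show "measure lebesgue (A \<inter> dyadic_cube j k) / side_length j ^ CARD('n)
      \<le> (side_length i / side_length j) ^ CARD('n)"
    using V by (simp add: power_divide divide_right_mono less_imp_le)
qed simp_all

section \<open>Growth envelopes of Morrey spaces\<close>

text \<open>At height \<open>2 / L\<close> Chebyshev's inequality gives the level set density at
  most \<open>2 powr (- p) < 1\<close> in every cube, so it is null; the factor 2 secures the strict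
  inequality.\<close>

lemma growth_envelope_bounded:
  fixes \<phi> :: "real \<Rightarrow> real"
  assumes p: "0 < p" and L: "0 < L" "\<And>t. 0 < t \<Longrightarrow> L \<le> \<phi> t" and t: "0 < t"
  shows "growth_envelope (morrey_space \<phi> p :: (real ^ 'n \<Rightarrow> complex) set) (morrey_qnorm \<phi> p) t \<le> ennreal (2 / L)"
  unfolding growth_envelope_def
proof (rule SUP_least)
  fix f :: "real ^ 'n \<Rightarrow> complex"
  assume "f \<in> {f \<in> morrey_space \<phi> p. morrey_qnorm \<phi> p f \<le> 1}"
  then have f: "f \<in> Lp_loc p" "morrey_qnorm \<phi> p f \<le> 1" by (auto simp: morrey_space_def)
  have "emeasure lebesgue {x. norm (f x) > 2 / L} = 0"
  proof (rule null_set_if_small_density_on_cubes[where \<theta> = "2 powr (- p)"])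
    show "{x. norm (f x) > 2 / L} \<in> sets lebesgue" using f(1) by (rule level_set_sets)
    show "(2::real) powr (- p) < 1" using p by (simp add: powr_less_one)
    show "measure lebesgue ({x. norm (f x) > 2 / L} \<inter> dyadic_cube j k) \<le> 2 powr (- p) * side_length j ^ CARD('n)" for j k
      using measure_level_set_cube_le[OF f p, of "2 / L" L j k] L by simp
  qed simp
  then show "rearrangement f t \<le> ennreal (2 / L)"
    using L by (intro rearrangement_le) auto
qed

text \<open>Tested on the characteristic function of one cube, normalised by \<phi>. Half the volume
  is taken because \<open>growth_envelope_ge\<close> needs \<open>t\<close> strictly below the
  measure.\<close>

lemma growth_envelope_ge_inverse:
  assumes G: "\<phi> \<in> class_G CARD('n) p" and p: "0 < p"
  shows "ennreal (1 / \<phi> (side_length j)) \<le>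
    growth_envelope (morrey_space \<phi> p :: (real ^ 'n \<Rightarrow> complex) set) (morrey_qnorm \<phi> p) (side_length j ^ CARD('n) / 2)"
proof (rule growth_envelope_ge[where A = "dyadic_cube j 0"])
  show "0 < 1 / \<phi> (side_length j)" using class_G_pos[OF G side_length_pos] by simp
  show "\<phi> (side_length i) * (measure lebesgue (dyadic_cube j 0 \<inter> dyadic_cube i k) /
       side_length i ^ CARD('n)) powr (1 / p) \<le> 1 / (1 / \<phi> (side_length j))" for i and k :: "int ^ 'n"
    using class_G_cube_share_le[OF G p, of "dyadic_cube j 0" i k j 0] by simp
qed (use p in \<open>simp_all add: measure_dyadic_cube less_imp_le\<close>)

text \<open>Supplies the existence of the limit in part (i); a bounded envelope then only has to
  give a positive lower bound of \<phi>.\<close>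

lemma tendsto_at_right_Inf_mono:
  fixes \<phi> :: "real \<Rightarrow> real"
  assumes mono: "\<And>s t. 0 < s \<Longrightarrow> s \<le> t \<Longrightarrow> \<phi> s \<le> \<phi> t" and bdd: "bdd_below (\<phi> ` {0<..})"
  shows "(\<phi> \<longlongrightarrow> Inf (\<phi> ` {0<..})) (at_right 0)"
proof (rule order_tendstoI)
  fix a assume a: "a < Inf (\<phi> ` {0<..})"
  show "\<forall>\<^sub>F x in at_right 0. a < \<phi> x"
    using eventually_at_right_less[of "0::real"]
  proof eventually_elim
    case (elim x)
    then have "Inf (\<phi> ` {0<..}) \<le> \<phi> x" by (intro cInf_lower bdd) auto
    with a show ?case by simp
  qed
next
  fix a assume "Inf (\<phi> ` {0<..}) < a"
  then obtain y where y: "0 < y" "\<phi> y < a"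
    using cInf_lessD[of "\<phi> ` {0<..}" a] by auto
  have "\<forall>\<^sub>F x in at_right 0. x \<in> {0<..<y}"
    using y(1) by (rule eventually_at_right_real)
  then show "\<forall>\<^sub>F x in at_right 0. \<phi> x < a"
  proof eventually_elim
    case (elim x)
    then show ?case using mono[of x y] y by auto
  qed
qed

lemma growth_envelope_bounded_iff:
  fixes \<phi> :: "real \<Rightarrow> real"
  assumes p: "0 < p" and G: "\<phi> \<in> class_G CARD('n::finite) p"
  defines "E \<equiv> growth_envelope (morrey_space \<phi> p :: (real ^ 'n \<Rightarrow> complex) set) (morrey_qnorm \<phi> p)"
  shows "(\<exists>C::real. \<forall>t>0. E t \<le> ennreal C) \<longleftrightarrow> (\<exists>L>0. (\<phi> \<longlongrightarrow> L) (at_right 0))"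
proof
  assume "\<exists>C::real. \<forall>t>0. E t \<le> ennreal C"
  then obtain C where C: "\<And>t. 0 < t \<Longrightarrow> E t \<le> ennreal C" by blast
  \<comment> \<open>\<open>C\<close> may be zero or negative, while a reciprocal is about to be
    taken.\<close>
  define D where "D = max C 1"
  have D: "0 < D" "C \<le> D" by (auto simp: D_def)
  have low: "1 / D \<le> \<phi> t" if t: "0 < t" for t
  proof -
    obtain j where j: "side_length j \<le> t" using ex_side_length_le t by blast
    have "ennreal (1 / \<phi> (side_length j)) \<le> ennreal C"
      using growth_envelope_ge_inverse[OF G p, of j] C[of "side_length j ^ CARD('n) / 2"]
      unfolding E_def by (auto intro: order_trans)
    also have "\<dots> \<le> ennreal D" using D by (intro ennreal_leI)
    finally have "1 / \<phi> (side_length j) \<le> D" using D by simp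
    then have "1 / D \<le> \<phi> (side_length j)"
      using D class_G_pos[OF G side_length_pos[of j]] by (simp add: field_simps)
    also have "\<dots> \<le> \<phi> t" using class_G_mono[OF G side_length_pos j] .
    finally show ?thesis .
  qed
  have "bdd_below (\<phi> ` {0<..})" using low by (intro bdd_belowI[of _ "1 / D"]) auto
  then have "(\<phi> \<longlongrightarrow> Inf (\<phi> ` {0<..})) (at_right 0)"
    using class_G_mono[OF G] by (intro tendsto_at_right_Inf_mono)
  moreover have "1 / D \<le> Inf (\<phi> ` {0<..})" using low by (intro cInf_greatest) auto
  moreover have "0 < 1 / D" using D by simp
  ultimately show "\<exists>L>0. (\<phi> \<longlongrightarrow> L) (at_right 0)" by (meson less_le_trans)
next
  assume "\<exists>L>0. (\<phi> \<longlongrightarrow> L) (at_right 0)"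
  then obtain L where L: "0 < L" "(\<phi> \<longlongrightarrow> L) (at_right 0)" by blast
  have "L \<le> \<phi> t" if t: "0 < t" for t
  proof (rule tendsto_upperbound[OF L(2)])
    show "\<forall>\<^sub>F s in at_right 0. \<phi> s \<le> \<phi> t"
      using eventually_at_right_real[OF t] by eventually_elim (auto intro: class_G_mono[OF G])
  qed simp
  then have "\<forall>t>0. E t \<le> ennreal (2 / L)"
    using growth_envelope_bounded[OF p L(1)] unfolding E_def by blast
  then show "\<exists>C::real. \<forall>t>0. E t \<le> ennreal C" ..
qed

text \<open>On cubes of side \<open>r > 1\<close> the bound
  \<open>\<phi>(r) \<ge> r powr (d / p) / c\<close> cancels the volume in Chebyshev's inequality.
  The level set then has the same measure bound in all of them, which the covering by finitely many
  large cubes makes global.\<close>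

lemma growth_envelope_le_powr:
  fixes \<phi> :: "real \<Rightarrow> real"
  assumes p: "0 < p" and eq: "equiv_on {1<..} \<phi> (\<lambda>t. t powr (real CARD('n::finite) / p))"
  shows "\<exists>c>0. \<forall>t>0. growth_envelope (morrey_space \<phi> p :: (real ^ 'n \<Rightarrow> complex) set) (morrey_qnorm \<phi> p) t
    \<le> ennreal (c * t powr (- 1 / p))"
proof -
  obtain c where c: "0 < c" "\<And>t. 1 < t \<Longrightarrow> t powr (real CARD('n) / p) \<le> c * \<phi> t"
    using eq by (auto simp: equiv_on_def)
  obtain N where N: "0 < N" and covering:
    "\<And>A b. A \<in> sets (lebesgue :: (real ^ 'n) measure) \<Longrightarrow> 0 \<le> b \<Longrightarrow>
      (\<And>m k. 0 < m \<Longrightarrow> measure lebesgue (A \<inter> dyadic_cube (- int m) k) \<le> b) \<Longrightarrow>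
      emeasure lebesgue A \<le> ennreal (N * b)"
    using ex_emeasure_le_of_large_cubes[where 'n = 'n] by blast
  show ?thesis
  proof (intro exI[of _ "N powr (1 / p) * c"] conjI allI impI)
    fix t :: real assume t: "0 < t"
    \<comment> \<open>Chosen so that the global bound \<open>N * (\<sigma> / c) powr (- p)\<close>
      equals \<open>t\<close>.\<close>
    define \<sigma> where "\<sigma> = N powr (1 / p) * c * t powr (- 1 / p)"
    have \<sigma>: "0 < \<sigma>" using N c t by (simp add: \<sigma>_def)
    have \<sigma>p: "N * (\<sigma> / c) powr (- p) = t"
    proof -
      have "\<sigma> / c = (N / t) powr (1 / p)"
        using c N t by (simp add: \<sigma>_def powr_divide powr_minus field_simps)
      then have "(\<sigma> / c) powr (- p) = (N / t) powr (- 1)"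
        using p by (simp add: powr_powr)
      then show ?thesis using N t by (simp add: powr_minus)
    qed
    show "growth_envelope (morrey_space \<phi> p :: (real ^ 'n \<Rightarrow> complex) set) (morrey_qnorm \<phi> p) t
      \<le> ennreal (N powr (1 / p) * c * t powr (- 1 / p))"
      unfolding growth_envelope_def \<sigma>_def[symmetric]
    proof (rule SUP_least)
      fix f :: "real ^ 'n \<Rightarrow> complex"
      assume "f \<in> {f \<in> morrey_space \<phi> p. morrey_qnorm \<phi> p f \<le> 1}"
      then have f: "f \<in> Lp_loc p" "morrey_qnorm \<phi> p f \<le> 1" by (auto simp: morrey_space_def)
      have "emeasure lebesgue {x. norm (f x) > \<sigma>} \<le> ennreal (N * (\<sigma> / c) powr (- p))"
      proof (rule covering)
        show "{x. norm (f x) > \<sigma>} \<in> sets lebesgue" using f(1) by (rule level_set_sets)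
        fix m :: nat and k :: "int ^ 'n" assume m: "0 < m"
        let ?r = "side_length (- int m)"
        have r: "1 < ?r" using m by (simp add: side_length_minus_nat)
        define b where "b = ?r powr (real CARD('n) / p) / c"
        have b: "0 < b" "b \<le> \<phi> ?r"
          using c r by (auto simp: b_def field_simps)
        have "(\<sigma> * b) powr (- p) * ?r ^ CARD('n) = (\<sigma> / c * ?r powr (real CARD('n) / p)) powr (- p) * ?r ^ CARD('n)"
          by (simp add: b_def)
        also have "\<dots> = (\<sigma> / c) powr (- p) * (?r powr (- real CARD('n)) * ?r ^ CARD('n))"
          using \<sigma> c p by (subst powr_mult) (auto simp: powr_powr)
        also have "\<dots> = (\<sigma> / c) powr (- p)"
          using less_imp_neq[OF side_length_pos[of "- int m"]] by (simp add: powr_minus powr_realpow)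
        finally show "measure lebesgue ({x. norm (f x) > \<sigma>} \<inter> dyadic_cube (- int m) k) \<le> (\<sigma> / c) powr (- p)"
          using measure_level_set_cube_le[OF f p \<sigma> b, of k] by simp
      qed simp
      then show "rearrangement f t \<le> ennreal \<sigma>"
        using \<sigma> \<sigma>p by (intro rearrangement_le) auto
    qed
  qed (use N c in simp)
qed

text \<open>The test functions are large multiples of characteristic functions of unions of \<open>N\<close> small
  cubes so far apart that a cube meeting two of them is huge.\<close>

lemma growth_envelope_eq_top:
  fixes \<phi> :: "real \<Rightarrow> real"
  assumes p: "0 < p" and G: "\<phi> \<in> class_G CARD('n::finite) p"
    and u: "p < u" and c: "0 < c" "\<And>t. 0 < t \<Longrightarrow> \<phi> t \<le> c * t powr (real CARD('n) / u)" and t: "0 < t"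
  shows "growth_envelope (morrey_space \<phi> p :: (real ^ 'n \<Rightarrow> complex) set) (morrey_qnorm \<phi> p) t = \<infinity>"
proof -
  have main: "ennreal M \<le> growth_envelope (morrey_space \<phi> p :: (real ^ 'n \<Rightarrow> complex) set) (morrey_qnorm \<phi> p) t"
    if M: "0 < M" for M
  proof -
    let ?d = "real CARD('n)"
    \<comment> \<open>Solves \<open>c * \<epsilon> powr (d / u) = 1 / M\<close>, so that \<phi> is
      at most \<open>1 / M\<close> at sides up to \<epsilon>.\<close>
    define \<epsilon> where "\<epsilon> = (1 / (c * M)) powr (u / ?d)"
    have \<epsilon>: "0 < \<epsilon>" using c M by (simp add: \<epsilon>_def)
    obtain j where j: "side_length j \<le> \<epsilon>" using ex_side_length_le[OF \<epsilon>] by blast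
    define s where "s = side_length j"
    have s: "0 < s" by (simp add: s_def)
    have "\<phi> s \<le> c * s powr (?d / u)" using c s by blast
    also have "\<dots> \<le> c * \<epsilon> powr (?d / u)"
      using c s j u p by (intro mult_left_mono powr_mono2) (auto simp: s_def less_imp_le)
    also have "\<dots> = 1 / M"
      using c M u p by (simp add: \<epsilon>_def powr_powr)
    finally have \<phi>s: "\<phi> s \<le> 1 / M" .
    \<comment> \<open>Enough cubes of side \<open>s\<close> for their total volume \<open>V\<close>
      to exceed \<open>t\<close>.\<close>
    obtain N :: nat where N: "t / s ^ CARD('n) < N" using reals_Archimedean2 by blast
    then have tN: "t < N * s ^ CARD('n)" using s by (simp add: field_simps)
    define V where "V = N * s ^ CARD('n)"
    have V: "0 < V" using tN t by (simp add: V_def)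
    \<comment> \<open>For a cube of side \<open>r\<close>, the growth \<open>r powr (d / u)\<close>
      of \<phi> meets the share factor \<open>r powr (- d / p)\<close>; since \<open>u > p\<close>,
      the product decays, and beyond \<open>R\<close> it is harmless.\<close>
    define \<delta> where "\<delta> = ?d / p - ?d / u"
    have \<delta>: "0 < \<delta>" using p u by (simp add: \<delta>_def divide_strict_left_mono)
    have "((\<lambda>r. c * V powr (1 / p) * r powr (- \<delta>)) \<longlongrightarrow> c * V powr (1 / p) * 0) at_top"
      using \<delta> by (intro tendsto_mult tendsto_const tendsto_neg_powr filterlim_ident) simp
    then have "\<forall>\<^sub>F r in at_top. c * V powr (1 / p) * r powr (- \<delta>) < 1 / M"
      using M by (intro order_tendstoD(2)) auto
    then obtain R where R: "\<And>r. R \<le> r \<Longrightarrow> c * V powr (1 / p) * r powr (- \<delta>) < 1 / M"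
      by (auto simp: eventually_at_top_linorder)
    obtain K0 :: nat where K0: "R / s < K0" using reals_Archimedean2 by blast
    \<comment> \<open>Spacing in grid cells: the added 1 is the cell that a cube itself occupies, so
      the gaps still measure at least \<open>R\<close>.\<close>
    define K where "K = int K0 + 1"
    have K: "1 \<le> K" "R \<le> s * (K - 1)" using K0 s by (auto simp: K_def field_simps)
    \<comment> \<open>Placing the cubes along the diagonal separates them in every coordinate at
      once.\<close>
    define Q where "Q m = (dyadic_cube j (\<chi> i. int m * K) :: (real ^ 'n) set)" for m
    have apart: "s * (K - 1) < \<bar>x $ i - y $ i\<bar>" if "x \<in> Q m" "y \<in> Q l" "m \<noteq> l" for x y m l i
    proof -
      have *: "s * (K - 1) < y $ i - x $ i" if "x \<in> Q m" "y \<in> Q l" "m < l" for x y m l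
      proof -
        have x: "x $ i < s * (int m * K + 1)" and y: "s * (int l * K) \<le> y $ i"
          using that by (auto simp: Q_def mem_dyadic_cube s_def)
        have "int m * K + K \<le> int l * K"
          using that K mult_right_mono[of "int m + 1" "int l" K] by (simp add: algebra_simps)
        then have "s * (int m * K + K) \<le> s * (int l * K)"
          using s by (intro mult_left_mono) linarith+
        then show ?thesis using x y by (simp add: algebra_simps)
      qed
      show ?thesis using *[of x m y l] *[of y l x m] that by (cases "m < l") auto
    qed
    have disj: "disjoint_family_on Q {..<N}"
    proof -
      have "Q m \<inter> Q l = {}" if "m \<noteq> l" for m l
      proof -
        have "0 \<le> s * (K - 1)" using s K by simp
        then show ?thesis using apart[OF _ _ that, of x x for x] by fastforce
      qed
      then show ?thesis by (auto simp: disjoint_family_on_def)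
    qed
    define A where "A = (\<Union>m<N. Q m)"
    have A: "A \<in> lmeasurable" unfolding A_def Q_def by (intro fmeasurable.finite_UN) auto
    have measure_A: "measure lebesgue A = V"
    proof -
      have "measure lebesgue A = (\<Sum>m<N. measure lebesgue (Q m))"
        unfolding A_def
        by (intro measure_finite_Union disj) (auto simp: Q_def emeasure_dyadic_cube)
      then show ?thesis by (simp add: Q_def measure_dyadic_cube V_def s_def)
    qed
    have N0: "0 < N" using V by (cases N) (auto simp: V_def)
    show ?thesis
    proof (rule growth_envelope_ge[OF A M p])
      show "t < measure lebesgue A" using tN measure_A by (simp add: V_def)
      fix i and k :: "int ^ 'n"
      define r where "r = side_length i"
      have r: "0 < r" by (simp add: r_def)
      show "\<phi> (side_length i) * (measure lebesgue (A \<inter> dyadic_cube i k) / side_length i ^ CARD('n)) powr (1 / p) \<le> 1 / M"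
      \<comment> \<open>If the tested cube sees only one \<open>Q m\<close>, the share inequality
        applies; otherwise its side exceeds \<open>R\<close> and the decay in \<open>r\<close> takes
        over.\<close>
      proof (cases "\<exists>m. A \<inter> dyadic_cube i k \<subseteq> Q m")
        case True
        then show ?thesis
          using class_G_cube_share_le[OF G p A, of i k j] \<phi>s by (force simp: Q_def s_def)
      next
        case False
        then obtain x where x: "x \<in> A" "x \<in> dyadic_cube i k" by blast
        then obtain m where m: "x \<in> Q m" by (auto simp: A_def)
        obtain y where y: "y \<in> A" "y \<in> dyadic_cube i k" "y \<notin> Q m" using False by blast
        then obtain l where l: "y \<in> Q l" by (auto simp: A_def)
        have "m \<noteq> l" using y l by blast
        then have "s * (K - 1) < r"
          using apart[OF m l] dyadic_cube_component_diff[OF x(2) y(2)] unfolding r_def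
          by (meson less_trans)
        then have Rr: "R \<le> r" using K by linarith
        have "measure lebesgue (A \<inter> dyadic_cube i k) \<le> V"
          using measure_mono_fmeasurable[of "A \<inter> dyadic_cube i k" A lebesgue] A measure_A
          by (auto simp: fmeasurable_def)
        then have "(measure lebesgue (A \<inter> dyadic_cube i k) / r ^ CARD('n)) powr (1 / p) \<le> (V / r ^ CARD('n)) powr (1 / p)"
          using r p by (intro powr_mono2 divide_right_mono) auto
        also have "\<dots> = V powr (1 / p) * r powr (- ?d / p)"
          using r V by (simp add: powr_divide powr_minus powr_powr field_simps flip: powr_realpow)
        finally have "\<phi> r * (measure lebesgue (A \<inter> dyadic_cube i k) / r ^ CARD('n)) powr (1 / p)
            \<le> (c * r powr (?d / u)) * (V powr (1 / p) * r powr (- ?d / p))"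
          using c r class_G_pos[OF G r] by (intro mult_mono) auto
        also have "\<dots> = c * V powr (1 / p) * r powr (- \<delta>)"
          by (simp add: \<delta>_def powr_diff powr_minus field_simps)
        also have "\<dots> \<le> 1 / M" using R[OF Rr] by simp
        finally show ?thesis by (simp add: r_def)
      qed
    qed (use t in simp)
  qed
  have "of_nat m \<le> growth_envelope (morrey_space \<phi> p :: (real ^ 'n \<Rightarrow> complex) set) (morrey_qnorm \<phi> p) t" for m
    using main[of "real m"] by (cases "m = 0") (auto simp: ennreal_of_nat_eq_real_of_nat)
  then show ?thesis
    unfolding infinity_ennreal_def by (metis SUP_least ennreal_SUP_of_nat_eq_top top.extremum_unique)
qed

text \<open>Boundedness asks for a real \<open>C\<close> because \<open>E\<close> takes values in
  \<open>ennreal\<close>, where infinity bounds everything.\<close>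

theorem corollary2p15:
  fixes p :: real and \<phi> :: "real \<Rightarrow> real"
  assumes "0 < p"
    and "\<phi> \<in> class_G CARD('n::finite) p"
    and "\<phi> 1 = 1"
  shows "let E = growth_envelope (morrey_space \<phi> p :: (real ^ 'n \<Rightarrow> complex) set) (morrey_qnorm \<phi> p)
    in ((\<exists>C::real. \<forall>t>0. E t \<le> ennreal C) \<longleftrightarrow> (\<exists>L>0. (\<phi> \<longlongrightarrow> L) (at_right 0)))
     \<and> (equiv_on {1<..} \<phi> (\<lambda>t. t powr (real CARD('n) / p)) \<longrightarrow>
          (\<exists>c>0. \<forall>t>0. E t \<le> ennreal (c * t powr (- 1 / p))))
     \<and> ((\<exists>u>p. \<exists>c>0. \<forall>t>0. \<phi> t \<le> c * t powr (real CARD('n) / u)) \<longrightarrow>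
          (\<forall>t>0. E t = \<infinity>))"
  unfolding Let_def
  using growth_envelope_bounded_iff[OF assms(1,2)] growth_envelope_le_powr[OF assms(1)]
    growth_envelope_eq_top[OF assms(1,2)]
  by blast

end
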